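(* Let $u$ be an entire or meromorphic function on $\mathbb{C}$ and let $A=u(z)\frac{d}{dz}$. Let $P(w)=c_0+c_1w+\dots+c_nw^n$ be a polynomial with complex coefficients. Let $\lambda\in\mathbb{C}$ and let $y=y(z)$ satisfy the equality $Ay=\lambda y$. Then for every $a,b\in\mathbb{C}$ the equality $$P(a+bA)\,y=P(a+b\lambda)\,y$$ holds.
   Context: For a linear differential operator $L$ and a polynomial $P(w)=\sum_{t=0}^n c_tw^t$, $P(L)=\sum_{t=0}^n c_tL^t$, where $L^t$ is the $t$-fold composition and $L^0$ is the identity; $a+bA$ denotes the operator $f\mapsto af+bAf$. Here $y$ is a meromorphic function on some domain of $\mathbb{C}$, and all equalities are equalities of functions on that domain. *)

theory Defs
  imports "HOL-Complex_Analysis.Complex_Analysis"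
begin

text \<open>
  Meromorphic functions are represented, as in the library, by total functions
  \<^typ>\<open>complex \<Rightarrow> complex\<close> whose values at the singularities carry no information
  (with \<open>u = 1/z\<close> and \<open>y = exp (z^2/2)\<close>, the pointwise product of \<open>u\<close> and \<open>deriv y\<close>
  takes a junk value at 0, although its singularity there is removable).
  Accordingly, equality of two meromorphic functions on a domain \<open>D\<close> is equality outside a set
  that is sparse in \<open>D\<close>, written with \<^const>\<open>cosparse\<close>. By the lemma
  \<open>meromorphic_eq_iff\<close> below this is the same as literal equality, at every point of \<open>D\<close>,
  of the canonical representatives, in which the removable singularities have been removed.
\<close>

lemma meromorphic_eq_iff:
  fixes f g :: "complex \<Rightarrow> complex"
  assumes "f meromorphic_on D" "g meromorphic_on D" "open D"
  shows "(\<forall>\<^sub>\<approx>z\<in>D. f z = g z) \<longleftrightarrow> (\<forall>z\<in>D. remove_sings f z = remove_sings g z)"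
proof
  assume eq: "\<forall>\<^sub>\<approx>z\<in>D. f z = g z"
  show "\<forall>z\<in>D. remove_sings f z = remove_sings g z"
  proof
    fix z assume "z \<in> D"
    then have "eventually (\<lambda>w. f w = g w) (at z)"
      using eq assms(3) by (simp add: eventually_cosparse_open_eq)
    then show "remove_sings f z = remove_sings g z"
      by (rule remove_sings_cong) simp
  qed
next
  assume eq: "\<forall>z\<in>D. remove_sings f z = remove_sings g z"
  have "\<forall>\<^sub>\<approx>z\<in>D. z \<in> D"
    by (intro eventually_in_cosparse assms order.refl)
  moreover have "\<forall>\<^sub>\<approx>z\<in>D. remove_sings f z = f z" "\<forall>\<^sub>\<approx>z\<in>D. remove_sings g z = g z"
    using assms by (auto intro: eventually_remove_sings_eq)
  ultimately show "\<forall>\<^sub>\<approx>z\<in>D. f z = g z"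
    by eventually_elim (use eq in auto)
qed

definition deriv_op :: "(complex \<Rightarrow> complex) \<Rightarrow> (complex \<Rightarrow> complex) \<Rightarrow> complex \<Rightarrow> complex" where
  "deriv_op u f = (\<lambda>z. u z * deriv f z)"

definition affine_op ::
  "complex \<Rightarrow> complex \<Rightarrow> ((complex \<Rightarrow> complex) \<Rightarrow> complex \<Rightarrow> complex) \<Rightarrow>
   (complex \<Rightarrow> complex) \<Rightarrow> complex \<Rightarrow> complex" where
  "affine_op a b A f = (\<lambda>z. a * f z + b * A f z)"

definition poly_op ::
  "complex poly \<Rightarrow> ((complex \<Rightarrow> complex) \<Rightarrow> complex \<Rightarrow> complex) \<Rightarrow>
   (complex \<Rightarrow> complex) \<Rightarrow> complex \<Rightarrow> complex" where
  "poly_op P L f = (\<lambda>z. \<Sum>t\<le>degree P. coeff P t * (L ^^ t) f z)"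

end

theory Submission
  imports Defs
begin

text \<open>An eigenfunction \<open>y\<close> of A with eigenvalue \<open>l\<close> is an
  eigenfunction of \<open>a + b * A\<close> with eigenvalue \<open>a + b * l\<close>; iterating
  gives the powers, and linear combination gives P. The only delicate point is that equalities hold
  off a sparse set, while \<open>deriv\<close> sees a whole neighbourhood. On an open set this costs
  nothing: \<open>eventually_cosparse_nhds\<close> upgrades pointwise to local equality, so
  \<open>affine_op_deriv_op_eigen\<close> can differentiate it.\<close>

lemma eventually_cosparse_nhds:
  fixes D :: "'a :: t1_space set"
  assumes "open D" and "\<forall>\<^sub>\<approx>z\<in>D. Q z"
  shows "\<forall>\<^sub>\<approx>z\<in>D. eventually Q (nhds z)"
proof -
  have "eventually (\<lambda>w. eventually Q (nhds w)) (at z)" if "z \<in> D" for z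
  proof -
    have "eventually Q (at z)"
      using assms that by (simp add: eventually_cosparse_open_eq)
    then obtain S where S: "open S" "z \<in> S" "\<And>w. w \<in> S \<Longrightarrow> w \<noteq> z \<Longrightarrow> Q w"
      unfolding eventually_at_topological by auto
    \<comment> \<open>Points are closed, so deleting \<open>z\<close> from \<open>S\<close> leaves
      an open neighbourhood of \<open>w\<close> on which \<open>Q\<close> holds throughout.\<close>
    have "eventually Q (nhds w)" if "w \<in> S" "w \<noteq> z" for w
      unfolding eventually_nhds using S that by (intro exI[of _ "S - {z}"]) auto
    with S show ?thesis
      unfolding eventually_at_topological by blast
  qed
  with \<open>open D\<close> show ?thesis
    by (simp add: eventually_cosparse_open_eq)
qed

text \<open>This is the induction step for the iterates: \<open>f\<close> is an earlier iterate,
  known only to agree with a multiple of \<open>y\<close> off a sparse set.\<close>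

lemma affine_op_deriv_op_eigen:
  fixes u y f :: "complex \<Rightarrow> complex" and D :: "complex set" and l a b c :: complex
  assumes "open D" and "y meromorphic_on D"
    and "\<forall>\<^sub>\<approx>z\<in>D. deriv_op u y z = l * y z"
    and "\<forall>\<^sub>\<approx>z\<in>D. f z = c * y z"
  shows "\<forall>\<^sub>\<approx>z\<in>D. affine_op a b (deriv_op u) f z = (a + b * l) * c * y z"
proof -
  have "\<forall>\<^sub>\<approx>z\<in>D. y analytic_on {z}"
    using assms(2) by (rule meromorphic_on_imp_analytic_cosparse)
  moreover have "\<forall>\<^sub>\<approx>z\<in>D. eventually (\<lambda>w. f w = c * y w) (nhds z)"
    using assms(1,4) by (rule eventually_cosparse_nhds)
  ultimately show ?thesis
    using assms(3)
  proof eventually_elim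
    case (elim z)
    have "f z = c * y z"
      using elim(2) by (rule eventually_nhds_x_imp_x)
    moreover have "deriv f z = deriv (\<lambda>w. c * y w) z"
      using elim(2) by (rule deriv_cong_ev) simp
    \<comment> \<open>Pulling out \<open>c\<close> uses differentiability of \<open>y\<close> at
      \<open>z\<close>, hence the restriction to points where \<open>y\<close> is analytic.\<close>
    moreover have "\<dots> = c * deriv y z"
      using elim(1) by (intro deriv_cmult analytic_on_imp_differentiable_at) auto
    ultimately have "affine_op a b (deriv_op u) f z = a * c * y z + b * c * deriv_op u y z"
      by (simp add: affine_op_def deriv_op_def mult_ac)
    with elim(3) show ?case
      by (simp add: algebra_simps)
  qed
qed

theorem theorem1p2:
  fixes u y :: "complex \<Rightarrow> complex" and D :: "complex set"
    and P :: "complex poly" and l a b :: complex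
  assumes "u meromorphic_on UNIV"
    and "open D" and "connected D" and "D \<noteq> {}"
    and "y meromorphic_on D"
    and "\<forall>\<^sub>\<approx>z\<in>D. deriv_op u y z = l * y z"
  shows "\<forall>\<^sub>\<approx>z\<in>D. poly_op P (affine_op a b (deriv_op u)) y z = poly P (a + b * l) * y z"
proof -
  define L where "L = affine_op a b (deriv_op u)"
  have "\<forall>\<^sub>\<approx>z\<in>D. (L ^^ t) y z = (a + b * l) ^ t * y z" for t
  proof (induction t)
    case (Suc t)
    then show ?case
      using affine_op_deriv_op_eigen[OF assms(2,5,6)] by (simp add: L_def)
  qed simp
  \<comment> \<open>Each exponent has its own exceptional set; only finitely many exponents occur in
    P, so one sparse set serves them all.\<close>
  then have "\<forall>\<^sub>\<approx>z\<in>D. \<forall>t\<in>{..degree P}. (L ^^ t) y z = (a + b * l) ^ t * y z"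
    by (intro eventually_ball_finite) auto
  then show ?thesis
    unfolding L_def[symmetric]
    by eventually_elim (simp add: poly_op_def poly_altdef sum_distrib_right mult.assoc)
qed

end
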